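(* Let $K$ be a field, $\sigma$ an automorphism of $K$ with fixed field $F=\mathrm{Fix}(\sigma)$, $R=K[t;\sigma]$, and let $f(t)=t^m-\sum_{i=0}^{m-1}a_it^i\in R$ be a monic polynomial of degree $m\ge 2$ which is not right invariant. Write $N=\mathrm{Nuc}(S_f)$. Suppose that there exists $s\in\{1,2,\dots,m-1\}$ such that $f\in \mathrm{Fix}(\sigma^s)[t;\sigma]$. (i) If $m=qs$ for some positive integer $q$, then $$N\oplus Nt^s\oplus Nt^{2s}\oplus\dots\oplus Nt^{(q-1)s}\oplus N\Bigl(\sum_{i=0}^{m-1}a_it^i\Bigr)$$ is an $F$-sub vector space of $\mathrm{Nuc}_r(S_f)$. (ii) If $m=qs+r$ for some positive integers $q,r$ with $0<r<s$, then $$N\oplus Nt^s\oplus Nt^{2s}\oplus\dots\oplus Nt^{qs}$$ is an $F$-sub vector space of $\mathrm{Nuc}_r(S_f)$.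
   Context: $R=K[t;\sigma]$ is the twisted polynomial ring: polynomials $\sum b_it^i$ with $b_i\in K$, termwise addition, and multiplication determined by $ta=\sigma(a)t$ for $a\in K$. For an automorphism $\tau$ of $K$, $\mathrm{Fix}(\tau)=\{a\in K:\tau(a)=a\}$; $f\in\mathrm{Fix}(\sigma^s)[t;\sigma]$ means that all coefficients of $f$ lie in $\mathrm{Fix}(\sigma^s)$. $f$ is right invariant if $Rf$ is a two-sided ideal of $R$. The Petit algebra $S_f$ is the unital nonassociative $F$-algebra with underlying additive group $\{g\in R:\deg g<m\}$ and multiplication $g\circ h=gh\,\mathrm{mod}_r f$, the remainder of $gh$ under right division by $f$. Left, middle and right nucleus are $\mathrm{Nuc}_l(S_f)=\{x:(xy)z=x(yz)\ \forall y,z\}$, $\mathrm{Nuc}_m(S_f)=\{x:(yx)z=y(xz)\ \forall y,z\}$, $\mathrm{Nuc}_r(S_f)=\{x:(yz)x=y(zx)\ \forall y,z\}$ (with $x,y,z\in S_f$ and products taken in $S_f$), and $\mathrm{Nuc}(S_f)=\mathrm{Nuc}_l(S_f)\cap\mathrm{Nuc}_m(S_f)\cap\mathrm{Nuc}_r(S_f)$; for $f$ not right invariant, $\mathrm{Nuc}_l(S_f)=\mathrm{Nuc}_m(S_f)=K$, so $N\subset K$.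
   Formalization: In (i) the sum is shown to be an F-subspace; it is direct only if ∑a_i t^i is not in N+Nt^s+…+Nt^{(q-1)s}, so directness is stated under that condition. It can fail: f=t^2-1, s=1, σ of order 3 gives N(∑a_i t^i)=N. *)

theory Defs
  imports
    "HOL-Algebra.Algebraic_Closure_Type"
    "HOL-Library.Set_Algebras"
    "HOL-Library.FuncSet"
    "HOL-Computational_Algebra.Polynomial"
begin

text \<open>
  The field \<open>K\<close> is a type of class \<^class>\<open>field\<close>; as a ring record it is
  \<open>ring_of_type_algebra\<close>. An automorphism of \<open>K\<close> is an element of
  \<open>ring_iso ring_of_type_algebra ring_of_type_algebra\<close>.
\<close>

definition Fix :: "('a \<Rightarrow> 'a) \<Rightarrow> 'a set" where
  "Fix \<tau> = {a. \<tau> a = a}"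

definition fixed_field :: "('a::field \<Rightarrow> 'a) \<Rightarrow> 'a ring" where
  "fixed_field \<tau> = ring_of_type_algebra\<lparr>carrier := Fix \<tau>\<rparr>"

text \<open>
  The twisted polynomial ring \<open>K[t;\<sigma>]\<close> has the same additive group as \<open>K[t]\<close>, with
  coefficients on the left. The rule \<open>t a = \<sigma>(a) t\<close> forces
  \<open>(b t\<^sup>i) (c t\<^sup>j) = b \<sigma>\<^sup>i(c) t\<^sup>i\<^sup>+\<^sup>j\<close>.
\<close>

definition skew_mult :: "('a::field \<Rightarrow> 'a) \<Rightarrow> 'a poly \<Rightarrow> 'a poly \<Rightarrow> 'a poly" where
  "skew_mult \<sigma> g h =
     (\<Sum>i\<le>degree g. \<Sum>j\<le>degree h. monom (coeff g i * (\<sigma> ^^ i) (coeff h j)) (i + j))"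

definition skew_poly_ring :: "('a::field \<Rightarrow> 'a) \<Rightarrow> 'a poly ring" where
  "skew_poly_ring \<sigma> =
     \<lparr>carrier = UNIV, monoid.mult = skew_mult \<sigma>, one = 1, ring.zero = 0, add = (+)\<rparr>"

definition right_invariant :: "('a::field \<Rightarrow> 'a) \<Rightarrow> 'a poly \<Rightarrow> bool" where
  "right_invariant \<sigma> f \<longleftrightarrow>
     ideal (carrier (skew_poly_ring \<sigma>) #>\<^bsub>skew_poly_ring \<sigma>\<^esub> f) (skew_poly_ring \<sigma>)"

text \<open>
  The remainder \<open>r\<close> in \<open>g = q f + r\<close>. It is used only for \<open>degree f > 0\<close>, where
  \<open>degree r < degree f\<close> also covers \<open>r = 0\<close>; see \<open>skew_mod_r_ex1\<close> below.
\<close>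

definition skew_mod_r :: "('a::field \<Rightarrow> 'a) \<Rightarrow> 'a poly \<Rightarrow> 'a poly \<Rightarrow> 'a poly" where
  "skew_mod_r \<sigma> g f = (THE r. degree r < degree f \<and> (\<exists>q. g = skew_mult \<sigma> q f + r))"

text \<open>
  The scalar multiplication is that of \<open>K\<close> from the left; restricted to \<open>Fix \<sigma>\<close> it gives
  the structure of an algebra over \<open>F\<close>.
\<close>

definition petit_algebra :: "('a::field \<Rightarrow> 'a) \<Rightarrow> 'a poly \<Rightarrow> ('a, 'a poly) module" where
  "petit_algebra \<sigma> f =
     \<lparr>carrier = {g. degree g < degree f},
      monoid.mult = (\<lambda>g h. skew_mod_r \<sigma> (skew_mult \<sigma> g h) f),
      one = 1, ring.zero = 0, add = (+), module.smult = Polynomial.smult\<rparr>"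

definition Nuc_l :: "('a, 'b) monoid_scheme \<Rightarrow> 'a set" where
  "Nuc_l A = {x \<in> carrier A. \<forall>y\<in>carrier A. \<forall>z\<in>carrier A.
     (x \<otimes>\<^bsub>A\<^esub> y) \<otimes>\<^bsub>A\<^esub> z = x \<otimes>\<^bsub>A\<^esub> (y \<otimes>\<^bsub>A\<^esub> z)}"

definition Nuc_m :: "('a, 'b) monoid_scheme \<Rightarrow> 'a set" where
  "Nuc_m A = {x \<in> carrier A. \<forall>y\<in>carrier A. \<forall>z\<in>carrier A.
     (y \<otimes>\<^bsub>A\<^esub> x) \<otimes>\<^bsub>A\<^esub> z = y \<otimes>\<^bsub>A\<^esub> (x \<otimes>\<^bsub>A\<^esub> z)}"

definition Nuc_r :: "('a, 'b) monoid_scheme \<Rightarrow> 'a set" where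
  "Nuc_r A = {x \<in> carrier A. \<forall>y\<in>carrier A. \<forall>z\<in>carrier A.
     (y \<otimes>\<^bsub>A\<^esub> z) \<otimes>\<^bsub>A\<^esub> x = y \<otimes>\<^bsub>A\<^esub> (z \<otimes>\<^bsub>A\<^esub> x)}"

definition Nuc :: "('a, 'b) monoid_scheme \<Rightarrow> 'a set" where
  "Nuc A = Nuc_l A \<inter> Nuc_m A \<inter> Nuc_r A"

text \<open>
  The sum of the family \<open>(A i)\<^sub>i\<close> is direct: every element of it is \<open>\<Sum>i\<in>I. x i\<close> for a
  unique choice of \<open>x i \<in> A i\<close>. The sum itself is the sum of sets of \<^theory>\<open>HOL-Library.Set_Algebras\<close>.
\<close>

definition direct_sum_family :: "'i set \<Rightarrow> ('i \<Rightarrow> 'b::comm_monoid_add set) \<Rightarrow> bool" where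
  "direct_sum_family I A \<longleftrightarrow> inj_on (\<lambda>x. \<Sum>i\<in>I. x i) (Pi\<^sub>E I A)"


lemma automorphism_simps:
  fixes \<sigma> :: "'a::field \<Rightarrow> 'a"
  assumes "\<sigma> \<in> ring_iso ring_of_type_algebra ring_of_type_algebra"
  shows "\<sigma> (a + b) = \<sigma> a + \<sigma> b" "\<sigma> (a * b) = \<sigma> a * \<sigma> b" "\<sigma> 1 = 1" "\<sigma> 0 = 0" "bij \<sigma>"
proof -
  show add: "\<sigma> (a + b) = \<sigma> a + \<sigma> b" for a b
    using assms by (auto simp: ring_iso_def ring_hom_def ring_of_type_algebra_def)
  show "\<sigma> (a * b) = \<sigma> a * \<sigma> b" "\<sigma> 1 = 1" "bij \<sigma>"
    using assms by (auto simp: ring_iso_def ring_hom_def ring_of_type_algebra_def)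
  show "\<sigma> 0 = 0" using add[of 0 0] by (metis add_cancel_right_left add.right_neutral)
qed

lemma automorphism_funpow_simps:
  fixes \<sigma> :: "'a::field \<Rightarrow> 'a"
  assumes "\<sigma> \<in> ring_iso ring_of_type_algebra ring_of_type_algebra"
  shows "(\<sigma> ^^ n) (a + b) = (\<sigma> ^^ n) a + (\<sigma> ^^ n) b" "(\<sigma> ^^ n) (a * b) = (\<sigma> ^^ n) a * (\<sigma> ^^ n) b"
    "(\<sigma> ^^ n) 1 = 1" "(\<sigma> ^^ n) 0 = 0" "bij (\<sigma> ^^ n)"
  using automorphism_simps[OF assms] by (induction n) (auto intro: bij_comp)

context
  fixes \<sigma> :: "'a::field \<Rightarrow> 'a"
  assumes \<sigma>: "\<sigma> \<in> ring_iso ring_of_type_algebra ring_of_type_algebra"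
begin

lemma skew_mult_bounds:
  assumes "degree g \<le> M" "degree h \<le> L"
  shows "skew_mult \<sigma> g h =
    (\<Sum>i\<le>M. \<Sum>j\<le>L. monom (coeff g i * (\<sigma> ^^ i) (coeff h j)) (i + j))"
proof -
  have "(\<Sum>j\<le>degree h. monom (coeff g i * (\<sigma> ^^ i) (coeff h j)) (i + j)) =
      (\<Sum>j\<le>L. monom (coeff g i * (\<sigma> ^^ i) (coeff h j)) (i + j))" for i
    using assms(2)
    by (intro sum.mono_neutral_left) (auto simp: coeff_eq_0 automorphism_funpow_simps[OF \<sigma>])
  then have "skew_mult \<sigma> g h =
      (\<Sum>i\<le>degree g. \<Sum>j\<le>L. monom (coeff g i * (\<sigma> ^^ i) (coeff h j)) (i + j))"
    unfolding skew_mult_def by simp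
  also have "\<dots> = (\<Sum>i\<le>M. \<Sum>j\<le>L. monom (coeff g i * (\<sigma> ^^ i) (coeff h j)) (i + j))"
    using assms(1) by (intro sum.mono_neutral_left) (auto simp: coeff_eq_0)
  finally show ?thesis .
qed

lemma skew_mult_add_left: "skew_mult \<sigma> (g + g') h = skew_mult \<sigma> g h + skew_mult \<sigma> g' h"
proof -
  let ?M = "max (degree g) (degree g')"
  have "degree (g + g') \<le> ?M" by (rule degree_add_le) auto
  then show ?thesis
    by (simp add: skew_mult_bounds[of _ ?M h "degree h"] distrib_right add_monom[symmetric]
        sum.distrib)
qed

lemma skew_mult_add_right: "skew_mult \<sigma> g (h + h') = skew_mult \<sigma> g h + skew_mult \<sigma> g h'"
proof -
  let ?M = "max (degree h) (degree h')"
  have "degree (h + h') \<le> ?M" by (rule degree_add_le) auto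
  then show ?thesis
    by (simp add: skew_mult_bounds[of g "degree g" _ ?M] distrib_left add_monom[symmetric]
        sum.distrib automorphism_funpow_simps[OF \<sigma>])
qed

lemma skew_mult_zero [simp]: "skew_mult \<sigma> 0 h = 0" "skew_mult \<sigma> g 0 = 0"
  by (simp_all add: skew_mult_def automorphism_funpow_simps[OF \<sigma>])

lemma skew_mult_sum_left: "skew_mult \<sigma> (\<Sum>i\<in>I. u i) h = (\<Sum>i\<in>I. skew_mult \<sigma> (u i) h)"
  by (induction I rule: infinite_finite_induct) (auto simp: skew_mult_add_left)

lemma skew_mult_sum_right: "skew_mult \<sigma> g (\<Sum>i\<in>I. u i) = (\<Sum>i\<in>I. skew_mult \<sigma> g (u i))"
  by (induction I rule: infinite_finite_induct) (auto simp: skew_mult_add_right)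

lemma skew_mult_monom:
  "skew_mult \<sigma> (monom a i) (monom b j) = monom (a * (\<sigma> ^^ i) b) (i + j)"
proof -
  have "skew_mult \<sigma> (monom a i) (monom b j) =
    (\<Sum>k\<le>i. \<Sum>l\<le>j. if k = i then if l = j then monom (a * (\<sigma> ^^ i) b) (i + j) else 0 else 0)"
    unfolding skew_mult_bounds[OF degree_monom_le degree_monom_le]
    by (intro sum.cong refl) (auto simp: automorphism_funpow_simps[OF \<sigma>])
  also have "\<dots> = (\<Sum>k\<le>i. if k = i then
      (\<Sum>l\<le>j. if l = j then monom (a * (\<sigma> ^^ i) b) (i + j) else 0) else 0)"
    by (intro sum.cong refl) auto
  finally show ?thesis by simp
qed

lemma skew_poly_induct [case_names add monom]:
  assumes "\<And>g h. P g \<Longrightarrow> P h \<Longrightarrow> P (g + h)" "\<And>c i. P (monom c i)"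
  shows "P (g :: 'a poly)"
proof -
  have "P (\<Sum>i\<le>n. monom (coeff g i) i)" for n
    by (induction n) (simp_all add: assms)
  then show ?thesis using poly_as_sum_of_monoms[of g] by metis
qed

lemma skew_mult_assoc: "skew_mult \<sigma> (skew_mult \<sigma> f g) h = skew_mult \<sigma> f (skew_mult \<sigma> g h)"
proof (induction f rule: skew_poly_induct)
  case (monom a i)
  show ?case
  proof (induction g rule: skew_poly_induct)
    case (monom b j)
    show ?case
    proof (induction h rule: skew_poly_induct)
      case (monom c k)
      show ?case
        by (simp add: skew_mult_monom automorphism_funpow_simps[OF \<sigma>] funpow_add mult.assoc add.assoc)
    qed (simp add: skew_mult_add_right)
  qed (simp add: skew_mult_add_left skew_mult_add_right)
qed (simp add: skew_mult_add_left)

lemma skew_mult_one [simp]: "skew_mult \<sigma> 1 h = h" "skew_mult \<sigma> h 1 = h"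
proof -
  have *: "(1 :: 'a poly) = monom 1 0" by simp
  have "skew_mult \<sigma> 1 (\<Sum>i\<le>degree h. monom (coeff h i) i) = (\<Sum>i\<le>degree h. monom (coeff h i) i)"
    "skew_mult \<sigma> (\<Sum>i\<le>degree h. monom (coeff h i) i) 1 = (\<Sum>i\<le>degree h. monom (coeff h i) i)"
    unfolding skew_mult_sum_right skew_mult_sum_left * skew_mult_monom
    by (simp_all add: automorphism_funpow_simps[OF \<sigma>])
  then show "skew_mult \<sigma> 1 h = h" "skew_mult \<sigma> h 1 = h"
    unfolding poly_as_sum_of_monoms by auto
qed

lemma skew_mult_t_const:
  "skew_mult \<sigma> (monom 1 1) [:a:] = skew_mult \<sigma> [:\<sigma> a:] (monom 1 1)"
  using skew_mult_monom[of 1 1 a 0] skew_mult_monom[of "\<sigma> a" 0 1 1] by (simp add: monom_0)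

lemma skew_mult_const: "skew_mult \<sigma> [:c:] h = Polynomial.smult c h"
proof (induction h rule: skew_poly_induct)
  case (monom b j)
  show ?case using skew_mult_monom[of c 0 b j] by (simp add: monom_0 smult_monom)
qed (simp add: skew_mult_add_right smult_add_right)

lemma coeff_skew_mult_top:
  "coeff (skew_mult \<sigma> g h) (degree g + degree h) =
    lead_coeff g * (\<sigma> ^^ degree g) (lead_coeff h)"
proof -
  have "coeff (skew_mult \<sigma> g h) (degree g + degree h) =
    (\<Sum>i\<le>degree g. \<Sum>j\<le>degree h. if i = degree g then if j = degree h then
      lead_coeff g * (\<sigma> ^^ degree g) (lead_coeff h) else 0 else 0)"
    unfolding skew_mult_def coeff_sum by (intro sum.cong refl) auto
  also have "\<dots> = (\<Sum>i\<le>degree g. if i = degree g then (\<Sum>j\<le>degree h. if j = degree h then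
      lead_coeff g * (\<sigma> ^^ degree g) (lead_coeff h) else 0) else 0)"
    by (intro sum.cong refl) auto
  finally show ?thesis by simp
qed

lemma degree_skew_mult:
  assumes "g \<noteq> 0" "h \<noteq> 0"
  shows "degree (skew_mult \<sigma> g h) = degree g + degree h"
proof (rule antisym)
  show "degree (skew_mult \<sigma> g h) \<le> degree g + degree h"
    unfolding skew_mult_def
    by (intro degree_sum_le) (auto intro: order.trans[OF degree_monom_le] add_mono)
  have "(\<sigma> ^^ degree g) (lead_coeff h) \<noteq> 0"
    using assms(2) automorphism_funpow_simps(4,5)[OF \<sigma>, of "degree g"]
    by (metis bij_is_inj injD leading_coeff_0_iff)
  then show "degree g + degree h \<le> degree (skew_mult \<sigma> g h)"
    using assms(1) by (intro le_degree) (simp add: coeff_skew_mult_top)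
qed

lemma skew_mod_r_ex1:
  assumes "0 < degree f"
  shows "\<exists>!r. degree r < degree f \<and> (\<exists>q. g = skew_mult \<sigma> q f + r)"
proof (rule ex_ex1I)
  have "f \<noteq> 0" using assms by auto
  show "\<exists>r. degree r < degree f \<and> (\<exists>q. g = skew_mult \<sigma> q f + r)"
  proof (induction "degree g" arbitrary: g rule: less_induct)
    case less
    show ?case
    proof (cases "degree g < degree f")
      case True
      then show ?thesis by (intro exI[of _ g]) (auto intro: exI[of _ 0])
    next
      case False
      define k where "k = degree g - degree f"
      have k: "degree g = k + degree f" using False by (simp add: k_def)
      define l where "l = (\<sigma> ^^ k) (lead_coeff f)"
      have "l \<noteq> 0"
        using \<open>f \<noteq> 0\<close> automorphism_funpow_simps(4,5)[OF \<sigma>, of k] unfolding l_def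
        by (metis bij_is_inj injD leading_coeff_0_iff)
      have "g \<noteq> 0" using False assms by auto
      define u where "u = monom (lead_coeff g / l) k"
      have u: "u \<noteq> 0" "degree u = k" "lead_coeff u = lead_coeff g / l"
        using \<open>g \<noteq> 0\<close> \<open>l \<noteq> 0\<close> by (auto simp: u_def degree_monom_eq)
      define g' where "g' = g - skew_mult \<sigma> u f"
      have "degree (skew_mult \<sigma> u f) = degree g"
        using degree_skew_mult[OF u(1) \<open>f \<noteq> 0\<close>] u k by simp
      then have le: "degree g' \<le> degree g"
        unfolding g'_def by (intro degree_diff_le) auto
      have "coeff (skew_mult \<sigma> u f) (degree g) = lead_coeff g"
        using coeff_skew_mult_top[of u f] u \<open>l \<noteq> 0\<close> unfolding k l_def by simp
      then have "coeff g' (degree g) = 0" unfolding g'_def by simp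
      moreover have "0 < degree g" using False assms by simp
      ultimately have "degree g' < degree g"
        using le by (metis degree_0 leading_coeff_0_iff le_neq_implies_less)
      from less[OF this] obtain r q where
        "degree r < degree f" "g' = skew_mult \<sigma> q f + r" by auto
      then have "g = skew_mult \<sigma> (u + q) f + r"
        unfolding g'_def by (simp add: skew_mult_add_left algebra_simps)
      with \<open>degree r < degree f\<close> show ?thesis by auto
    qed
  qed
next
  fix r r' assume "degree r < degree f \<and> (\<exists>q. g = skew_mult \<sigma> q f + r)"
    "degree r' < degree f \<and> (\<exists>q. g = skew_mult \<sigma> q f + r')"
  then obtain q q' where *: "degree r < degree f" "degree r' < degree f"
    "g = skew_mult \<sigma> q f + r" "g = skew_mult \<sigma> q' f + r'" by blast
  have "skew_mult \<sigma> q f = skew_mult \<sigma> (q - q') f + skew_mult \<sigma> q' f"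
    by (simp flip: skew_mult_add_left)
  then have eq: "skew_mult \<sigma> (q - q') f = r' - r" using *(3,4) by (simp add: algebra_simps)
  have "q - q' = 0"
  proof (rule ccontr)
    assume "q - q' \<noteq> 0"
    moreover have "f \<noteq> 0" using assms by auto
    ultimately have "degree f \<le> degree (r' - r)"
      using degree_skew_mult[of "q - q'" f] eq by simp
    moreover have "degree (r' - r) < degree f" using *(1,2) by (intro degree_diff_less)
    ultimately show False by simp
  qed
  with eq show "r = r'" by simp
qed

lemma ring_skew_poly_ring: "ring (skew_poly_ring \<sigma>)"
proof (rule ringI)
  show "abelian_group (skew_poly_ring \<sigma>)"
    by (rule abelian_groupI)
      (auto simp: skew_poly_ring_def add_ac intro: exI[of _ "- x" for x :: "'a poly"] add.left_inverse)
  show "Group.monoid (skew_poly_ring \<sigma>)"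
    by (rule monoidI) (auto simp: skew_poly_ring_def skew_mult_assoc)
qed (auto simp: skew_poly_ring_def skew_mult_add_left skew_mult_add_right)

end

end

theory Submission
  imports Defs
begin

text \<open>
  Everything rests on one subring of \<open>R\<close>, the idealizer \<open>I = {g. f g \<in> R f}\<close> of the left
  ideal \<open>R f\<close>, and on one formula for associators: if \<open>x y = q f + r\<close> with
  \<open>deg r < deg f\<close>, then modulo \<open>R f\<close> the associator of \<open>x, y, z\<close> in \<open>S\<^sub>f\<close> is \<open>- q f z\<close>
  (\<open>petit_mult_assoc_iff\<close>).

  An element of \<open>I\<close> in the third place makes this associator vanish, and the quotient \<open>q = 1\<close> occurs
  for suitable \<open>x, y\<close>, so \<open>Nuc\<^sub>r(S\<^sub>f) = {g \<in> I. deg g < m}\<close> (\<open>Nuc_r_petit_algebra\<close>). For \<open>x\<close> in the left nucleus of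
  positive degree some \<open>x y\<close> is monic of degree \<open>m\<close>, so again \<open>q = 1\<close>, and then \<open>f z \<in> R f\<close>
  for all \<open>z\<close>, which makes \<open>f\<close> right invariant. Hence, for \<open>f\<close> not right invariant, \<open>N\<close>
  consists exactly of the constants lying in \<open>I\<close> (\<open>Nuc_petit_algebra\<close>), and these form a subfield
  of \<open>K\<close> that contains \<open>F\<close>.

  As \<open>f\<close> has coefficients in \<open>Fix(\<sigma>\<^sup>s)\<close>, it commutes with \<open>t\<^sup>s\<close> and so with all powers of
  it: these powers lie in \<open>I\<close>. If \<open>s\<close> divides \<open>m\<close>, then \<open>t\<^sup>m\<close> and \<open>f\<close> are in \<open>I\<close>, and with them
  their difference \<open>\<Sum>a\<^sub>i t\<^sup>i\<close>. Since \<open>I\<close> is a ring, all the products of these elements with \<open>N\<close> are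
  in \<open>I\<close>, and those of degree less than \<open>m\<close> are in the right nucleus. The sum of the \<open>N t\<^sup>j\<^sup>s\<close> is
  direct because the exponents differ, and \<open>N p\<close> with \<open>p = \<Sum>a\<^sub>i t\<^sup>i\<close> meets this sum only in \<open>0\<close> unless it
  contains \<open>p\<close>, because nonzero elements of \<open>N\<close> can be inverted inside \<open>N\<close>.
\<close>

section \<open>Left ideals and idealizers in the twisted polynomial ring\<close>

definition principal_left_ideal :: "('a::field \<Rightarrow> 'a) \<Rightarrow> 'a poly \<Rightarrow> 'a poly set" where
  "principal_left_ideal \<sigma> f = range (\<lambda>u. skew_mult \<sigma> u f)"

text \<open>
  The condition \<open>f g \<in> R f\<close> is equivalent to \<open>R f g \<subseteq> R f\<close>, so this is the largest subring of \<open>R\<close>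
  in which \<open>R f\<close> is a two-sided ideal.
\<close>

definition idealizer :: "('a::field \<Rightarrow> 'a) \<Rightarrow> 'a poly \<Rightarrow> 'a poly set" where
  "idealizer \<sigma> f = {g. skew_mult \<sigma> f g \<in> principal_left_ideal \<sigma> f}"

definition idealizer_constants :: "('a::field \<Rightarrow> 'a) \<Rightarrow> 'a poly \<Rightarrow> 'a set" where
  "idealizer_constants \<sigma> f = {c. [:c:] \<in> idealizer \<sigma> f}"

context
  fixes \<sigma> :: "'a::field \<Rightarrow> 'a"
  assumes \<sigma>: "\<sigma> \<in> ring_iso ring_of_type_algebra ring_of_type_algebra"
begin

lemma skew_mult_diff_left: "skew_mult \<sigma> (g - g') h = skew_mult \<sigma> g h - skew_mult \<sigma> g' h"
  using skew_mult_add_left[OF \<sigma>, of "g - g'" g' h] by simp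

lemma skew_mult_diff_right: "skew_mult \<sigma> g (h - h') = skew_mult \<sigma> g h - skew_mult \<sigma> g h'"
  using skew_mult_add_right[OF \<sigma>, of g "h - h'" h'] by simp

lemma principal_left_ideal_zero: "0 \<in> principal_left_ideal \<sigma> f"
  unfolding principal_left_ideal_def using skew_mult_zero(1)[OF \<sigma>, of f] by (metis rangeI)

lemma principal_left_ideal_add:
  "g \<in> principal_left_ideal \<sigma> f \<Longrightarrow> h \<in> principal_left_ideal \<sigma> f \<Longrightarrow>
    g + h \<in> principal_left_ideal \<sigma> f"
  unfolding principal_left_ideal_def by (auto simp flip: skew_mult_add_left[OF \<sigma>])

lemma principal_left_ideal_diff:
  "g \<in> principal_left_ideal \<sigma> f \<Longrightarrow> h \<in> principal_left_ideal \<sigma> f \<Longrightarrow>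
    g - h \<in> principal_left_ideal \<sigma> f"
  unfolding principal_left_ideal_def by (auto simp flip: skew_mult_diff_left)

lemma principal_left_ideal_mult:
  "g \<in> principal_left_ideal \<sigma> f \<Longrightarrow> skew_mult \<sigma> h g \<in> principal_left_ideal \<sigma> f"
  unfolding principal_left_ideal_def by (auto simp flip: skew_mult_assoc[OF \<sigma>])

lemma principal_left_ideal_mult_idealizer:
  assumes "g \<in> principal_left_ideal \<sigma> f" "h \<in> idealizer \<sigma> f"
  shows "skew_mult \<sigma> g h \<in> principal_left_ideal \<sigma> f"
proof -
  obtain u where "g = skew_mult \<sigma> u f" using assms(1) by (auto simp: principal_left_ideal_def)
  then show ?thesis
    using assms(2) by (simp add: skew_mult_assoc[OF \<sigma>] idealizer_def principal_left_ideal_mult)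
qed

lemma idealizer_add:
  "g \<in> idealizer \<sigma> f \<Longrightarrow> h \<in> idealizer \<sigma> f \<Longrightarrow> g + h \<in> idealizer \<sigma> f"
  by (simp add: idealizer_def skew_mult_add_right[OF \<sigma>] principal_left_ideal_add)

lemma idealizer_diff:
  "g \<in> idealizer \<sigma> f \<Longrightarrow> h \<in> idealizer \<sigma> f \<Longrightarrow> g - h \<in> idealizer \<sigma> f"
  by (simp add: idealizer_def skew_mult_diff_right principal_left_ideal_diff)

lemma idealizer_mult:
  assumes "g \<in> idealizer \<sigma> f" "h \<in> idealizer \<sigma> f"
  shows "skew_mult \<sigma> g h \<in> idealizer \<sigma> f"
  using assms principal_left_ideal_mult_idealizer[of "skew_mult \<sigma> f g" f h]
  by (simp add: idealizer_def skew_mult_assoc[OF \<sigma>])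

lemma idealizer_self: "f \<in> idealizer \<sigma> f"
  by (simp add: idealizer_def principal_left_ideal_def)

lemma idealizer_zero: "0 \<in> idealizer \<sigma> f"
  by (simp add: idealizer_def principal_left_ideal_zero skew_mult_zero[OF \<sigma>])

lemma idealizer_smult:
  "c \<in> idealizer_constants \<sigma> f \<Longrightarrow> g \<in> idealizer \<sigma> f \<Longrightarrow> Polynomial.smult c g \<in> idealizer \<sigma> f"
  using idealizer_mult[of "[:c:]" f g]
  by (simp add: idealizer_constants_def skew_mult_const[OF \<sigma>])

text \<open>
  Moving \<open>t\<^sup>k\<close> past a coefficient of \<open>f\<close> applies \<open>\<sigma>\<^sup>k\<close> to it, which changes nothing: \<open>f\<close>
  commutes with \<open>t\<^sup>k\<close>.
\<close>

lemma idealizer_monom_one: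
  assumes "\<And>i. coeff f i \<in> Fix (\<sigma> ^^ k)"
  shows "monom 1 k \<in> idealizer \<sigma> f"
proof -
  have "skew_mult \<sigma> f (monom 1 k) = (\<Sum>i\<le>degree f. monom (coeff f i) (i + k))"
    by (subst poly_as_sum_of_monoms[of f, symmetric])
      (simp add: skew_mult_sum_left[OF \<sigma>] skew_mult_monom[OF \<sigma>] automorphism_funpow_simps[OF \<sigma>])
  also have "\<dots> = skew_mult \<sigma> (monom 1 k) (\<Sum>i\<le>degree f. monom (coeff f i) i)"
    using assms by (simp add: skew_mult_sum_right[OF \<sigma>] skew_mult_monom[OF \<sigma>] Fix_def add.commute)
  finally show ?thesis
    by (simp add: poly_as_sum_of_monoms idealizer_def principal_left_ideal_def)
qed

lemma Fix_subset_idealizer_constants: "Fix \<sigma> \<subseteq> idealizer_constants \<sigma> f"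
proof
  fix b assume "b \<in> Fix \<sigma>"
  then have b: "(\<sigma> ^^ i) b = b" for i by (induction i) (auto simp: Fix_def)
  have "skew_mult \<sigma> f [:b:] = (\<Sum>i\<le>degree f. Polynomial.smult b (monom (coeff f i) i))"
    by (subst poly_as_sum_of_monoms[of f, symmetric])
      (simp add: skew_mult_sum_left[OF \<sigma>] skew_mult_monom[OF \<sigma>] b smult_monom mult.commute
        flip: monom_0)
  also have "\<dots> = skew_mult \<sigma> [:b:] (\<Sum>i\<le>degree f. monom (coeff f i) i)"
    by (simp add: skew_mult_sum_right[OF \<sigma>] skew_mult_const[OF \<sigma>])
  finally show "b \<in> idealizer_constants \<sigma> f"
    by (simp add: poly_as_sum_of_monoms idealizer_constants_def idealizer_def
        principal_left_ideal_def)
qed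

lemma neg_one_in_idealizer_constants: "- 1 \<in> idealizer_constants \<sigma> f"
proof -
  have "\<sigma> (- 1) = - 1"
    using automorphism_simps(1)[OF \<sigma>, of 1 "- 1"] automorphism_simps(3,4)[OF \<sigma>]
    by (simp add: add_eq_0_iff)
  then show ?thesis using Fix_subset_idealizer_constants by (auto simp: Fix_def)
qed

lemma idealizer_constants_mult:
  "c \<in> idealizer_constants \<sigma> f \<Longrightarrow> d \<in> idealizer_constants \<sigma> f \<Longrightarrow>
    c * d \<in> idealizer_constants \<sigma> f"
  using idealizer_smult[of c f "[:d:]"] by (simp add: idealizer_constants_def)

lemma idealizer_constants_add:
  "c \<in> idealizer_constants \<sigma> f \<Longrightarrow> d \<in> idealizer_constants \<sigma> f \<Longrightarrow>
    c + d \<in> idealizer_constants \<sigma> f"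
  using idealizer_add[of "[:c:]" f "[:d:]"] by (simp add: idealizer_constants_def)

text \<open>
  Comparing degrees in \<open>f c = u f\<close> shows that \<open>u\<close> is a nonzero constant \<open>b\<close>; multiplying by
  \<open>b\<inverse>\<close> on the left and by \<open>c\<inverse>\<close> on the right turns this equation into \<open>f c\<inverse> = b\<inverse> f\<close>.
\<close>

lemma idealizer_constants_inverse:
  assumes "f \<noteq> 0" "c \<in> idealizer_constants \<sigma> f" "c \<noteq> 0"
  shows "inverse c \<in> idealizer_constants \<sigma> f"
proof -
  obtain u where u: "skew_mult \<sigma> f [:c:] = skew_mult \<sigma> u f"
    using assms(2) by (auto simp: idealizer_constants_def idealizer_def principal_left_ideal_def)
  have const: "skew_mult \<sigma> [:x:] [:y:] = [:x * y:]" for x y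
    by (simp add: skew_mult_const[OF \<sigma>])
  have deg: "degree (skew_mult \<sigma> f [:c:]) = degree f"
    using degree_skew_mult[OF \<sigma>, of f "[:c:]"] assms(1,3) by simp
  have "skew_mult \<sigma> (skew_mult \<sigma> f [:c:]) [:inverse c:] = f"
    using assms(3) by (simp add: skew_mult_assoc[OF \<sigma>] const skew_mult_one[OF \<sigma>] flip: one_pCons)
  then have uf: "skew_mult \<sigma> u (skew_mult \<sigma> f [:inverse c:]) = f"
    by (simp add: u skew_mult_assoc[OF \<sigma>])
  then have "u \<noteq> 0" using assms(1) by (auto simp: skew_mult_zero[OF \<sigma>])
  then have "degree u = 0" using degree_skew_mult[OF \<sigma>, of u f] assms(1) deg u by simp
  then obtain b where b: "u = [:b:]" by (rule degree_eq_zeroE)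
  then have "b \<noteq> 0" using \<open>u \<noteq> 0\<close> by simp
  have "skew_mult \<sigma> [:inverse b:] f =
      skew_mult \<sigma> [:inverse b:] (skew_mult \<sigma> u (skew_mult \<sigma> f [:inverse c:]))"
    by (simp only: uf)
  also have "\<dots> = skew_mult \<sigma> (skew_mult \<sigma> [:inverse b:] [:b:]) (skew_mult \<sigma> f [:inverse c:])"
    by (simp only: b skew_mult_assoc[OF \<sigma>])
  also have "\<dots> = skew_mult \<sigma> f [:inverse c:]"
    using \<open>b \<noteq> 0\<close> by (simp add: const skew_mult_one[OF \<sigma>] flip: one_pCons)
  finally have "skew_mult \<sigma> f [:inverse c:] = skew_mult \<sigma> [:inverse b:] f" ..
  then show ?thesis by (simp add: idealizer_constants_def idealizer_def principal_left_ideal_def)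
qed

lemma right_invariantI:
  assumes "\<And>z. z \<in> idealizer \<sigma> f"
  shows "right_invariant \<sigma> f"
proof -
  let ?R = "skew_poly_ring \<sigma>"
  have L: "carrier ?R #>\<^bsub>?R\<^esub> f = principal_left_ideal \<sigma> f"
    by (auto simp: r_coset_def skew_poly_ring_def principal_left_ideal_def)
  have ring: "ring ?R" by (rule ring_skew_poly_ring[OF \<sigma>])
  have "subgroup (principal_left_ideal \<sigma> f) (add_monoid ?R)"
  proof (rule group.subgroupI)
    show "group (add_monoid ?R)"
      using ring by (intro abelian_group.a_group) (rule ring.is_abelian_group)
    show "principal_left_ideal \<sigma> f \<noteq> {}" by (simp add: principal_left_ideal_def)
    fix g h assume gh: "g \<in> principal_left_ideal \<sigma> f" "h \<in> principal_left_ideal \<sigma> f"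
    then show "g \<otimes>\<^bsub>add_monoid ?R\<^esub> h \<in> principal_left_ideal \<sigma> f"
      by (simp add: skew_poly_ring_def principal_left_ideal_add)
    have "inv\<^bsub>add_monoid ?R\<^esub> g = 0 - g"
      by (rule group.inv_equality[OF \<open>group (add_monoid ?R)\<close>]) (auto simp: skew_poly_ring_def)
    then show "inv\<^bsub>add_monoid ?R\<^esub> g \<in> principal_left_ideal \<sigma> f"
      using gh principal_left_ideal_diff[OF principal_left_ideal_zero, of g f] by simp
  qed (simp add: skew_poly_ring_def)
  then show ?thesis
    unfolding right_invariant_def L using ring assms
    by (intro idealI)
      (auto simp: skew_poly_ring_def principal_left_ideal_mult principal_left_ideal_mult_idealizer)
qed

section \<open>The nuclei of a Petit algebra\<close>

lemma skew_mod_r_decomposition: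
  assumes "0 < degree f"
  obtains q where "g = skew_mult \<sigma> q f + skew_mod_r \<sigma> g f" "degree (skew_mod_r \<sigma> g f) < degree f"
  using theI'[OF skew_mod_r_ex1[OF \<sigma> assms, of g]] unfolding skew_mod_r_def by blast

lemma skew_mod_r_unique:
  assumes "degree r < degree f" "g = skew_mult \<sigma> q f + r"
  shows "skew_mod_r \<sigma> g f = r"
proof -
  have "0 < degree f" using assms(1) by simp
  then show ?thesis
    unfolding skew_mod_r_def using assms by (intro the1_equality skew_mod_r_ex1[OF \<sigma>]) auto
qed

lemma skew_mod_r_eq_iff:
  assumes "0 < degree f"
  shows "skew_mod_r \<sigma> g f = skew_mod_r \<sigma> h f \<longleftrightarrow> g - h \<in> principal_left_ideal \<sigma> f"
proof
  obtain q where q: "g = skew_mult \<sigma> q f + skew_mod_r \<sigma> g f"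
    "degree (skew_mod_r \<sigma> g f) < degree f"
    by (rule skew_mod_r_decomposition[OF assms])
  {
    obtain q' where q': "h = skew_mult \<sigma> q' f + skew_mod_r \<sigma> h f"
      by (rule skew_mod_r_decomposition[OF assms])
    assume "skew_mod_r \<sigma> g f = skew_mod_r \<sigma> h f"
    then have "g - h = skew_mult \<sigma> q f - skew_mult \<sigma> q' f"
      using q(1) q' by (metis add_diff_cancel_right)
    then show "g - h \<in> principal_left_ideal \<sigma> f"
      by (simp add: principal_left_ideal_def flip: skew_mult_diff_left)
  next
    assume "g - h \<in> principal_left_ideal \<sigma> f"
    then obtain u where "g - h = skew_mult \<sigma> u f" by (auto simp: principal_left_ideal_def)
    then have "h = skew_mult \<sigma> (q - u) f + skew_mod_r \<sigma> g f"
      using q(1) by (simp add: skew_mult_diff_left algebra_simps)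
    from skew_mod_r_unique[OF q(2) this]
    show "skew_mod_r \<sigma> g f = skew_mod_r \<sigma> h f" by simp
  }
qed

text \<open>
  Reducing \<open>y z\<close> before multiplying by \<open>x\<close> changes the product only by an element of the left ideal
  \<open>R f\<close>, whereas reducing \<open>x y\<close> before multiplying by \<open>z\<close> subtracts \<open>q f z\<close>, which need not lie
  in \<open>R f\<close>.
\<close>

lemma petit_mult_assoc_iff:
  assumes r: "degree r < degree f" and xy: "skew_mult \<sigma> x y = skew_mult \<sigma> q f + r"
  shows "(x \<otimes>\<^bsub>petit_algebra \<sigma> f\<^esub> y) \<otimes>\<^bsub>petit_algebra \<sigma> f\<^esub> z =
      x \<otimes>\<^bsub>petit_algebra \<sigma> f\<^esub> (y \<otimes>\<^bsub>petit_algebra \<sigma> f\<^esub> z) \<longleftrightarrow>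
    skew_mult \<sigma> q (skew_mult \<sigma> f z) \<in> principal_left_ideal \<sigma> f" (is "?assoc \<longleftrightarrow> ?Q \<in> ?L")
proof -
  have f: "0 < degree f" using r by simp
  define w where "w = skew_mod_r \<sigma> (skew_mult \<sigma> y z) f"
  obtain q' where yz: "skew_mult \<sigma> y z = skew_mult \<sigma> q' f + w"
    unfolding w_def by (rule skew_mod_r_decomposition[OF f])
  define U where "U = skew_mult \<sigma> x (skew_mult \<sigma> q' f)"
  have U: "U \<in> ?L"
    unfolding U_def by (rule principal_left_ideal_mult) (simp add: principal_left_ideal_def)
  have "?assoc \<longleftrightarrow> skew_mult \<sigma> r z - skew_mult \<sigma> x w \<in> ?L"
    by (simp add: petit_algebra_def skew_mod_r_unique[OF r xy] skew_mod_r_eq_iff[OF f]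
        flip: w_def)
  also have "skew_mult \<sigma> r z - skew_mult \<sigma> x w = U - ?Q"
  proof -
    have "skew_mult \<sigma> (skew_mult \<sigma> x y) z = skew_mult \<sigma> x (skew_mult \<sigma> y z)"
      by (rule skew_mult_assoc[OF \<sigma>])
    then show ?thesis
      unfolding xy yz U_def
      by (simp add: skew_mult_add_left[OF \<sigma>] skew_mult_add_right[OF \<sigma>] skew_mult_assoc[OF \<sigma>]
          algebra_simps)
  qed
  also have "U - ?Q \<in> ?L \<longleftrightarrow> ?Q \<in> ?L"
    using principal_left_ideal_diff[OF U, of ?Q] principal_left_ideal_diff[OF U, of "U - ?Q"] by auto
  finally show ?thesis .
qed

lemma skew_mult_degree_less_petit_assoc:
  assumes "degree (skew_mult \<sigma> x y) < degree f"
  shows "(x \<otimes>\<^bsub>petit_algebra \<sigma> f\<^esub> y) \<otimes>\<^bsub>petit_algebra \<sigma> f\<^esub> z =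
      x \<otimes>\<^bsub>petit_algebra \<sigma> f\<^esub> (y \<otimes>\<^bsub>petit_algebra \<sigma> f\<^esub> z)"
  using petit_mult_assoc_iff[OF assms, of x y 0 z]
  by (simp add: skew_mult_zero[OF \<sigma>] principal_left_ideal_zero)

lemma monic_product_petit_assoc_iff:
  assumes "0 < degree f" "lead_coeff f = 1"
    and "degree (skew_mult \<sigma> x y) = degree f" "lead_coeff (skew_mult \<sigma> x y) = 1"
  shows "(x \<otimes>\<^bsub>petit_algebra \<sigma> f\<^esub> y) \<otimes>\<^bsub>petit_algebra \<sigma> f\<^esub> z =
      x \<otimes>\<^bsub>petit_algebra \<sigma> f\<^esub> (y \<otimes>\<^bsub>petit_algebra \<sigma> f\<^esub> z) \<longleftrightarrow> z \<in> idealizer \<sigma> f"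
proof -
  define r where "r = skew_mult \<sigma> x y - f"
  have "degree r \<le> degree f" unfolding r_def using assms(3) by (intro degree_diff_le) auto
  moreover have "coeff r (degree f) = 0" using assms(2-4) by (simp add: r_def)
  ultimately have r: "degree r < degree f"
    using assms(1) by (metis degree_0 leading_coeff_0_iff le_neq_implies_less)
  have "skew_mult \<sigma> x y = skew_mult \<sigma> 1 f + r" by (simp add: r_def skew_mult_one[OF \<sigma>])
  from petit_mult_assoc_iff[OF r this, of z] show ?thesis
    by (simp add: idealizer_def skew_mult_one[OF \<sigma>])
qed

text \<open>
  The right nucleus consists of those \<open>x\<close> for which \<open>q f x \<in> R f\<close> for every quotient \<open>q\<close> of a
  product \<open>y z\<close> by \<open>f\<close>. All these conditions follow from the one for \<open>q = 1\<close>, and \<open>q = 1\<close> does occur.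
\<close>

lemma Nuc_r_petit_algebra:
  assumes "2 \<le> degree f" "lead_coeff f = 1"
  shows "Nuc_r (petit_algebra \<sigma> f) = {g \<in> idealizer \<sigma> f. degree g < degree f}"
proof -
  let ?S = "petit_algebra \<sigma> f"
  have f: "0 < degree f" using assms(1) by simp
  have carrier: "carrier ?S = {g. degree g < degree f}" by (simp add: petit_algebra_def)
  show ?thesis
  proof (intro equalityI subsetI)
    fix x assume x: "x \<in> Nuc_r ?S"
    \<comment> \<open>The product \<open>t\<^sup>m\<^sup>-\<^sup>1 t\<close> has quotient \<open>1\<close>, and both factors lie in the carrier since \<open>m \<ge> 2\<close>.\<close>
    let ?y = "monom 1 (degree f - 1) :: 'a poly" and ?z = "monom 1 1 :: 'a poly"
    have "skew_mult \<sigma> ?y ?z = monom 1 (degree f)"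
      using f by (simp add: skew_mult_monom[OF \<sigma>] automorphism_funpow_simps[OF \<sigma>])
    moreover have "?y \<in> carrier ?S" "?z \<in> carrier ?S"
      using assms(1) by (auto simp: carrier degree_monom_eq)
    ultimately have "x \<in> idealizer \<sigma> f"
      using x monic_product_petit_assoc_iff[OF f assms(2), of ?y ?z x]
      by (simp add: Nuc_r_def degree_monom_eq)
    then show "x \<in> {g \<in> idealizer \<sigma> f. degree g < degree f}"
      using x by (auto simp: Nuc_r_def carrier)
  next
    fix x assume x: "x \<in> {g \<in> idealizer \<sigma> f. degree g < degree f}"
    have "(y \<otimes>\<^bsub>?S\<^esub> z) \<otimes>\<^bsub>?S\<^esub> x = y \<otimes>\<^bsub>?S\<^esub> (z \<otimes>\<^bsub>?S\<^esub> x)" for y z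
    proof -
      obtain q where q: "skew_mult \<sigma> y z = skew_mult \<sigma> q f + skew_mod_r \<sigma> (skew_mult \<sigma> y z) f"
        "degree (skew_mod_r \<sigma> (skew_mult \<sigma> y z) f) < degree f"
        by (rule skew_mod_r_decomposition[OF f])
      have "skew_mult \<sigma> q (skew_mult \<sigma> f x) \<in> principal_left_ideal \<sigma> f"
        using x by (intro principal_left_ideal_mult[of "skew_mult \<sigma> f x"]) (simp add: idealizer_def)
      then show ?thesis using petit_mult_assoc_iff[OF q(2,1)] by simp
    qed
    then show "x \<in> Nuc_r ?S" using x by (simp add: Nuc_r_def carrier)
  qed
qed

text \<open>
  An element \<open>x\<close> of positive degree \<open>k\<close> can be completed to a monic product \<open>x y\<close> of degree \<open>m\<close>
  with \<open>deg y = m - k < m\<close>. If \<open>x\<close> is in the left nucleus, this puts every \<open>z\<close> of degree less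
  than \<open>m\<close> into the idealizer, in particular all constants and \<open>t\<close>, which generate \<open>R\<close>.
\<close>

lemma Nuc_l_petit_algebra_degree:
  assumes deg: "2 \<le> degree f" and monic: "lead_coeff f = 1" and "\<not> right_invariant \<sigma> f"
    and x: "x \<in> Nuc_l (petit_algebra \<sigma> f)"
  shows "degree x = 0"
proof (rule ccontr)
  let ?S = "petit_algebra \<sigma> f"
  have f: "0 < degree f" using deg by simp
  have carrier: "carrier ?S = {g. degree g < degree f}" by (simp add: petit_algebra_def)
  assume "degree x \<noteq> 0"
  then have x0: "x \<noteq> 0" by auto
  have xdeg: "degree x < degree f" using x by (simp add: Nuc_l_def carrier)
  have "surj (\<sigma> ^^ degree x)" using automorphism_funpow_simps(5)[OF \<sigma>] by (rule bij_is_surj)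
  then obtain b where b: "inverse (lead_coeff x) = (\<sigma> ^^ degree x) b" by (rule surjE)
  have "b \<noteq> 0" using b x0 automorphism_funpow_simps(4)[OF \<sigma>, of "degree x"] by auto
  define y where "y = monom b (degree f - degree x)"
  have y: "y \<noteq> 0" "degree y = degree f - degree x" "lead_coeff y = b"
    using \<open>b \<noteq> 0\<close> by (auto simp: y_def degree_monom_eq)
  have xy: "degree (skew_mult \<sigma> x y) = degree f"
    using degree_skew_mult[OF \<sigma> x0 y(1)] y(2) xdeg by simp
  have "coeff (skew_mult \<sigma> x y) (degree x + degree y) = 1"
    unfolding coeff_skew_mult_top[OF \<sigma>] y(3) using x0 by (simp flip: b)
  then have "lead_coeff (skew_mult \<sigma> x y) = 1" using xy y(2) xdeg by simp
  moreover have "y \<in> carrier ?S" using y(2) \<open>degree x \<noteq> 0\<close> f by (simp add: carrier)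
  ultimately have low: "z \<in> idealizer \<sigma> f" if "degree z < degree f" for z
    using x that monic_product_petit_assoc_iff[OF f monic xy, of z]
    by (simp add: Nuc_l_def carrier)
  have t: "monom 1 i \<in> idealizer \<sigma> f" for i
  proof (induction i)
    case 0
    show ?case using f by (intro low) simp
  next
    case (Suc i)
    have "monom 1 1 \<in> idealizer \<sigma> f" using deg by (intro low) (simp add: degree_monom_eq)
    from idealizer_mult[OF this Suc] show ?case
      by (simp add: skew_mult_monom[OF \<sigma>] automorphism_funpow_simps[OF \<sigma>] automorphism_simps[OF \<sigma>])
  qed
  have "z \<in> idealizer \<sigma> f" for z
  proof (induction z rule: skew_poly_induct[OF \<sigma>, case_names add monom])
    case (monom c i)
    have "[:c:] \<in> idealizer \<sigma> f" using f by (intro low) simp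
    from idealizer_mult[OF this t[of i]] show ?case by (simp add: skew_mult_const[OF \<sigma>] smult_monom)
  qed (rule idealizer_add)
  then have "right_invariant \<sigma> f" by (rule right_invariantI)
  with assms(3) show False by simp
qed

lemma Nuc_petit_algebra:
  assumes "2 \<le> degree f" "lead_coeff f = 1" "\<not> right_invariant \<sigma> f"
  shows "Nuc (petit_algebra \<sigma> f) = (\<lambda>c. [:c:]) ` idealizer_constants \<sigma> f"
proof (intro equalityI subsetI)
  fix x assume x: "x \<in> Nuc (petit_algebra \<sigma> f)"
  then have "degree x = 0" using Nuc_l_petit_algebra_degree[OF assms] by (simp add: Nuc_def)
  then obtain c where "x = [:c:]" by (rule degree_eq_zeroE)
  then show "x \<in> (\<lambda>c. [:c:]) ` idealizer_constants \<sigma> f"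
    using x Nuc_r_petit_algebra[OF assms(1,2)] by (auto simp: Nuc_def idealizer_constants_def)
next
  let ?S = "petit_algebra \<sigma> f"
  have f: "0 < degree f" using assms(1) by simp
  have carrier: "carrier ?S = {g. degree g < degree f}" by (simp add: petit_algebra_def)
  fix x assume "x \<in> (\<lambda>c. [:c:]) ` idealizer_constants \<sigma> f"
  then obtain c where c: "x = [:c:]" "[:c:] \<in> idealizer \<sigma> f"
    by (auto simp: idealizer_constants_def)
  \<comment> \<open>Multiplication by a constant on either side does not raise the degree, so nothing has to be
    reduced in \<open>x y\<close> and \<open>y x\<close>.\<close>
  have "(x \<otimes>\<^bsub>?S\<^esub> y) \<otimes>\<^bsub>?S\<^esub> z = x \<otimes>\<^bsub>?S\<^esub> (y \<otimes>\<^bsub>?S\<^esub> z)"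
    "(y \<otimes>\<^bsub>?S\<^esub> x) \<otimes>\<^bsub>?S\<^esub> z = y \<otimes>\<^bsub>?S\<^esub> (x \<otimes>\<^bsub>?S\<^esub> z)" if "degree y < degree f" for y z
  proof -
    have "degree (skew_mult \<sigma> x y) < degree f" "degree (skew_mult \<sigma> y x) < degree f"
      using that f degree_skew_mult[OF \<sigma>, of x y] degree_skew_mult[OF \<sigma>, of y x] c(1)
      by (cases "x = 0 \<or> y = 0"; auto simp: skew_mult_zero[OF \<sigma>])+
    then show "(x \<otimes>\<^bsub>?S\<^esub> y) \<otimes>\<^bsub>?S\<^esub> z = x \<otimes>\<^bsub>?S\<^esub> (y \<otimes>\<^bsub>?S\<^esub> z)"
      "(y \<otimes>\<^bsub>?S\<^esub> x) \<otimes>\<^bsub>?S\<^esub> z = y \<otimes>\<^bsub>?S\<^esub> (x \<otimes>\<^bsub>?S\<^esub> z)"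
      by (auto intro: skew_mult_degree_less_petit_assoc)
  qed
  then have "x \<in> Nuc_l ?S" "x \<in> Nuc_m ?S" using f c(1) by (auto simp: Nuc_l_def Nuc_m_def carrier)
  moreover have "x \<in> Nuc_r ?S" using Nuc_r_petit_algebra[OF assms(1,2)] c f by simp
  ultimately show "x \<in> Nuc ?S" by (simp add: Nuc_def)
qed

end

section \<open>Subspaces over a set of scalars and direct sums\<close>

text \<open>
  A notion of subspace for which the scalars are a subset of the coefficient type: here the
  scalars are the constants of an idealizer, which depend on \<open>f\<close>. Closure under negation comes from
  \<open>- 1\<close> being a scalar.
\<close>

definition scalar_subspace :: "'a::field set \<Rightarrow> 'a poly set \<Rightarrow> bool" where
  "scalar_subspace E V \<longleftrightarrow>
     0 \<in> V \<and> (\<forall>g\<in>V. \<forall>h\<in>V. g + h \<in> V) \<and> (\<forall>c\<in>E. \<forall>g\<in>V. Polynomial.smult c g \<in> V)"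

lemma scalar_subspace_plus:
  assumes "scalar_subspace E V" "scalar_subspace E W"
  shows "scalar_subspace E (V + W)"
  unfolding scalar_subspace_def
proof (intro conjI ballI)
  show "0 \<in> V + W"
    using assms set_plus_intro[of 0 V 0 W] by (simp add: scalar_subspace_def)
next
  fix g h assume "g \<in> V + W" "h \<in> V + W"
  then obtain v w v' w' where *: "g = v + w" "h = v' + w'" "v \<in> V" "v' \<in> V" "w \<in> W" "w' \<in> W"
    by (auto elim!: set_plus_elim)
  then have "(v + v') + (w + w') \<in> V + W"
    using assms by (intro set_plus_intro) (auto simp: scalar_subspace_def)
  then show "g + h \<in> V + W" using * by (simp add: add_ac)
next
  fix c g assume c: "c \<in> E" and "g \<in> V + W"
  then obtain v w where "g = v + w" "v \<in> V" "w \<in> W" by (auto elim!: set_plus_elim)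
  then show "Polynomial.smult c g \<in> V + W"
    using assms c by (auto simp: scalar_subspace_def smult_add_right intro!: set_plus_intro)
qed

lemma scalar_subspace_sum:
  assumes "\<And>i. i \<in> I \<Longrightarrow> scalar_subspace E (A i)"
  shows "scalar_subspace E (\<Sum>i\<in>I. A i)"
  using assms
proof (induction I rule: infinite_finite_induct)
  case (insert i I)
  then show ?case by (simp add: scalar_subspace_plus)
qed (auto simp: scalar_subspace_def)

lemma plus_subset_scalar_subspace:
  "scalar_subspace E W \<Longrightarrow> A \<subseteq> W \<Longrightarrow> B \<subseteq> W \<Longrightarrow> A + B \<subseteq> W"
  by (auto simp: scalar_subspace_def elim!: set_plus_elim)

lemma sum_subset_scalar_subspace:
  assumes "scalar_subspace E W" "\<And>i. i \<in> I \<Longrightarrow> A i \<subseteq> W"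
  shows "(\<Sum>i\<in>I. A i) \<subseteq> W"
  using assms(2)
proof (induction I rule: infinite_finite_induct)
  case (insert i I)
  then show ?case by (simp add: plus_subset_scalar_subspace[OF assms(1)])
qed (use assms(1) in \<open>auto simp: scalar_subspace_def\<close>)

lemma scalar_subspace_diff:
  assumes "scalar_subspace E V" "- 1 \<in> E" "g \<in> V" "h \<in> V"
  shows "g - h \<in> V"
proof -
  have "g + Polynomial.smult (- 1) h \<in> V" using assms unfolding scalar_subspace_def by blast
  then show ?thesis by simp
qed

lemma direct_sum_family_monom:
  assumes "finite I" "inj_on e I" "\<And>i. i \<in> I \<Longrightarrow> A i \<subseteq> range (\<lambda>c. monom c (e i))"
  shows "direct_sum_family I A"
  unfolding direct_sum_family_def
proof (rule inj_onI)
  fix x y assume x: "x \<in> Pi\<^sub>E I A" and y: "y \<in> Pi\<^sub>E I A" and eq: "(\<Sum>i\<in>I. x i) = (\<Sum>i\<in>I. y i)"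
  have coeff: "z i = monom (coeff (\<Sum>k\<in>I. z k) (e i)) (e i)" if "z \<in> Pi\<^sub>E I A" "i \<in> I" for z i
  proof -
    have "\<exists>c. z k = monom c (e k)" if "k \<in> I" for k
      using assms(3)[OF that] PiE_mem[OF \<open>z \<in> Pi\<^sub>E I A\<close> that] by auto
    then obtain c where c: "\<And>k. k \<in> I \<Longrightarrow> z k = monom (c k) (e k)" by metis
    have "coeff (\<Sum>k\<in>I. z k) (e i) = (\<Sum>k\<in>I. if k = i then c k else 0)"
      unfolding coeff_sum using c assms(2) that(2) by (intro sum.cong refl) (auto dest: inj_onD)
    also have "\<dots> = c i" using assms(1) that(2) by simp
    finally show ?thesis using c[OF that(2)] by simp
  qed
  have "x i = y i" if "i \<in> I" for i using coeff[OF x that] coeff[OF y that] eq by metis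
  then show "x = y" using x y by (rule PiE_ext[rotated 2])
qed

text \<open>
  If two sums over \<open>insert k I\<close> agree, the difference of their components at \<open>k\<close> is a difference of
  sums over \<open>I\<close>, hence lies in the trivial intersection.
\<close>

lemma direct_sum_family_insert:
  assumes I: "finite I" "k \<notin> I" and A: "direct_sum_family I A"
    and sub: "\<And>i. i \<in> insert k I \<Longrightarrow> scalar_subspace E (A i)" and "- 1 \<in> E"
    and triv: "A k \<inter> (\<Sum>i\<in>I. A i) \<subseteq> {0}"
  shows "direct_sum_family (insert k I) A"
  unfolding direct_sum_family_def
proof (rule inj_onI)
  fix x y assume x: "x \<in> Pi\<^sub>E (insert k I) A" and y: "y \<in> Pi\<^sub>E (insert k I) A"
    and "(\<Sum>i\<in>insert k I. x i) = (\<Sum>i\<in>insert k I. y i)"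
  then have eq: "x k + (\<Sum>i\<in>I. x i) = y k + (\<Sum>i\<in>I. y i)" using I by simp
  have mem: "(\<Sum>i\<in>I. z i) \<in> (\<Sum>i\<in>I. A i)" if "z \<in> Pi\<^sub>E (insert k I) A" for z
    using that I(1) by (auto simp: set_sum_alt)
  have "x k - y k = (\<Sum>i\<in>I. y i) - (\<Sum>i\<in>I. x i)" using eq by (simp add: algebra_simps)
  moreover have "x k - y k \<in> A k"
    using x y sub \<open>- 1 \<in> E\<close> by (intro scalar_subspace_diff) (auto dest: PiE_mem)
  moreover have "(\<Sum>i\<in>I. y i) - (\<Sum>i\<in>I. x i) \<in> (\<Sum>i\<in>I. A i)"
    using sub mem[OF x] mem[OF y] \<open>- 1 \<in> E\<close>
    by (intro scalar_subspace_diff scalar_subspace_sum) auto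
  ultimately have k: "x k = y k" using triv by auto
  have "restrict x I = restrict y I"
  proof (rule inj_onD[OF A[unfolded direct_sum_family_def]])
    show "(\<Sum>i\<in>I. restrict x I i) = (\<Sum>i\<in>I. restrict y I i)" using eq k by simp
  qed (use x y in \<open>auto dest: PiE_mem\<close>)
  then have "x i = y i" if "i \<in> I" for i using that by (metis restrict_apply')
  with k show "x = y" by (intro PiE_ext[OF x y]) auto
qed

text \<open>
  The inverse in the ambient record is taken inside its carrier, the right nucleus; it is the
  negative of polynomials because the right nucleus, too, is closed under negation.
\<close>

lemma submodule_petit_algebraI:
  assumes V: "scalar_subspace E V" and "V \<subseteq> Nuc_r (petit_algebra \<sigma> f)"
    and E: "Fix \<sigma> \<subseteq> E" "- 1 \<in> E" and Nuc: "scalar_subspace E (Nuc_r (petit_algebra \<sigma> f))"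
  shows "submodule V (fixed_field \<sigma>) (petit_algebra \<sigma> f\<lparr>carrier := Nuc_r (petit_algebra \<sigma> f)\<rparr>)"
    (is "submodule V _ ?M")
proof -
  have neg: "- g \<in> W" if "scalar_subspace E W" "g \<in> W" for g W
    using that E(2) scalar_subspace_diff[OF that(1) E(2), of 0 g] by (auto simp: scalar_subspace_def)
  have inv: "inv\<^bsub>add_monoid ?M\<^esub> g = - g" if "g \<in> V" for g
  proof -
    have "- g \<in> Nuc_r (petit_algebra \<sigma> f)" using that assms(2) Nuc neg by blast
    then show ?thesis
      unfolding m_inv_def by (intro the_equality) (auto simp: petit_algebra_def eq_neg_iff_add_eq_0)
  qed
  have "subgroup V (add_monoid ?M)"
  proof
    fix g assume "g \<in> V"
    then show "inv\<^bsub>add_monoid ?M\<^esub> g \<in> V" using inv neg[OF V] by simp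
  qed (use V assms(2) in \<open>auto simp: petit_algebra_def scalar_subspace_def\<close>)
  then show ?thesis
    using V E(1)
    by (intro submodule.intro submodule_axioms.intro)
      (auto simp: scalar_subspace_def fixed_field_def petit_algebra_def)
qed

section \<open>Subspaces of the right nucleus\<close>

theorem proposition8:
  fixes \<sigma> :: "'a::field \<Rightarrow> 'a" and a :: "nat \<Rightarrow> 'a" and m s :: nat
    and f p :: "'a poly" and N :: "'a poly set"
    and F :: "'a ring" and R :: "'a poly ring" and S :: "('a, 'a poly) module"
  assumes "\<sigma> \<in> ring_iso ring_of_type_algebra ring_of_type_algebra"
    and "F = fixed_field \<sigma>"
    and "R = skew_poly_ring \<sigma>"
    and "2 \<le> m"
    and "p = (\<Sum>i<m. monom (a i) i)"
    and "f = monom 1 m - p"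
    and "\<not> right_invariant \<sigma> f"
    and "S = petit_algebra \<sigma> f"
    and "N = Nuc S"
    and "s \<in> {1..m - 1}"
    and "\<forall>i. coeff f i \<in> Fix (\<sigma> ^^ s)"
  shows
    "(\<forall>q>0. m = q * s \<longrightarrow>
        submodule ((\<Sum>j<q. N #>\<^bsub>R\<^esub> monom 1 (j * s)) + (N #>\<^bsub>R\<^esub> p)) F (S\<lparr>carrier := Nuc_r S\<rparr>) \<and>
        direct_sum_family {..<q} (\<lambda>j. N #>\<^bsub>R\<^esub> monom 1 (j * s)) \<and>
        (p \<notin> (\<Sum>j<q. N #>\<^bsub>R\<^esub> monom 1 (j * s)) \<longrightarrow>
          direct_sum_family {..q} (\<lambda>j. if j < q then N #>\<^bsub>R\<^esub> monom 1 (j * s) else N #>\<^bsub>R\<^esub> p))) \<and>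
     (\<forall>q>0. \<forall>r. 0 < r \<and> r < s \<and> m = q * s + r \<longrightarrow>
        submodule (\<Sum>j\<le>q. N #>\<^bsub>R\<^esub> monom 1 (j * s)) F (S\<lparr>carrier := Nuc_r S\<rparr>) \<and>
        direct_sum_family {..q} (\<lambda>j. N #>\<^bsub>R\<^esub> monom 1 (j * s)))"
proof -
  note \<sigma> = assms(1)
  have s: "0 < s" using assms(10) by simp
  have "degree p \<le> m - 1"
    unfolding assms(5) by (intro degree_sum_le) (auto intro: order.trans[OF degree_monom_le])
  then have p: "degree p < m" using assms(4) by simp
  then have "degree (- p) < degree (monom (1 :: 'a) m)" by (simp add: degree_monom_eq)
  from degree_add_eq_left[OF this] have deg: "degree f = m"
    unfolding assms(6) by (simp add: degree_monom_eq)
  have monic: "lead_coeff f = 1" unfolding deg using p by (simp add: assms(6) coeff_eq_0)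
  have f0: "f \<noteq> 0" using monic by auto
  define E where "E = idealizer_constants \<sigma> f"
  have E: "Fix \<sigma> \<subseteq> E" "- 1 \<in> E"
    unfolding E_def using Fix_subset_idealizer_constants[OF \<sigma>] neg_one_in_idealizer_constants[OF \<sigma>]
    by auto
  have N: "N = (\<lambda>c. [:c:]) ` E"
    unfolding E_def assms(8,9) using Nuc_petit_algebra[OF \<sigma> _ monic assms(7)] assms(4) deg by simp
  have Nuc_r: "Nuc_r S = {g \<in> idealizer \<sigma> f. degree g < m}"
    unfolding assms(8) using Nuc_r_petit_algebra[OF \<sigma> _ monic] assms(4) deg by simp
  have Nuc_r_sub: "scalar_subspace E (Nuc_r S)"
    unfolding scalar_subspace_def Nuc_r E_def using assms(4)
    by (auto simp: idealizer_zero[OF \<sigma>] idealizer_add[OF \<sigma>] idealizer_smult[OF \<sigma>]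
        intro: degree_add_less order.strict_trans1[OF degree_smult_le])
  have coset: "N #>\<^bsub>R\<^esub> g = (\<lambda>c. Polynomial.smult c g) ` E" for g
    unfolding N assms(3) r_coset_def skew_poly_ring_def by (auto simp: skew_mult_const[OF \<sigma>])
  have coset_sub: "scalar_subspace E (N #>\<^bsub>R\<^esub> g)" for g
    unfolding scalar_subspace_def coset
  proof (intro conjI ballI)
    have "0 \<in> E" using idealizer_zero[OF \<sigma>] by (simp add: E_def idealizer_constants_def)
    then show "0 \<in> (\<lambda>c. Polynomial.smult c g) ` E" by (metis image_eqI smult_0_left)
  qed (auto simp: E_def idealizer_constants_add[OF \<sigma>] idealizer_constants_mult[OF \<sigma>]
      simp flip: smult_add_left)
  have coset_Nuc_r: "N #>\<^bsub>R\<^esub> g \<subseteq> Nuc_r S" if "g \<in> idealizer \<sigma> f" "degree g < m" for g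
    using that Nuc_r_sub unfolding coset scalar_subspace_def by (auto simp: Nuc_r)
  have t: "monom 1 (j * s) \<in> idealizer \<sigma> f" for j
  proof (rule idealizer_monom_one[OF \<sigma>])
    fix i
    have "((\<sigma> ^^ s) ^^ j) (coeff f i) = coeff f i"
      using assms(11) by (induction j) (auto simp: Fix_def)
    then show "coeff f i \<in> Fix (\<sigma> ^^ (j * s))" by (simp add: Fix_def funpow_mult mult.commute)
  qed
  have t_coset: "N #>\<^bsub>R\<^esub> monom 1 (j * s) \<subseteq> Nuc_r S" if "j * s < m" for j
    using that by (intro coset_Nuc_r t) (simp add: degree_monom_eq)
  have direct: "direct_sum_family J (\<lambda>j. N #>\<^bsub>R\<^esub> monom 1 (j * s))" if "finite J" for J
    using that s
    by (intro direct_sum_family_monom[where e = "\<lambda>j. j * s"])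
      (auto simp: coset smult_monom intro: inj_onI)
  have submod: "submodule V F (S\<lparr>carrier := Nuc_r S\<rparr>)"
    if "scalar_subspace E V" "V \<subseteq> Nuc_r S" for V
    using submodule_petit_algebraI[OF that(1) _ E] that(2) Nuc_r_sub unfolding assms(2,8) by blast
  show ?thesis
  proof (intro conjI allI impI)
    fix q assume q: "0 < q" "m = q * s"
    let ?A = "\<lambda>j. N #>\<^bsub>R\<^esub> monom 1 (j * s)"
    \<comment> \<open>Here \<open>t\<^sup>m = t\<^sup>q\<^sup>s\<close> lies in the idealizer, and \<open>p = t\<^sup>m - f\<close>.\<close>
    have "p \<in> idealizer \<sigma> f"
      using idealizer_diff[OF \<sigma> t[of q] idealizer_self[OF \<sigma>]] q(2) by (simp add: assms(6))
    then have p_coset: "N #>\<^bsub>R\<^esub> p \<subseteq> Nuc_r S" using p by (rule coset_Nuc_r)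
    have "(\<Sum>j<q. ?A j) \<subseteq> Nuc_r S"
      using s q(2) by (intro sum_subset_scalar_subspace[OF Nuc_r_sub] t_coset) simp
    then show "submodule ((\<Sum>j<q. ?A j) + (N #>\<^bsub>R\<^esub> p)) F (S\<lparr>carrier := Nuc_r S\<rparr>)"
      using p_coset
      by (intro submod scalar_subspace_plus scalar_subspace_sum coset_sub
          plus_subset_scalar_subspace[OF Nuc_r_sub])
    show "direct_sum_family {..<q} ?A" by (rule direct) simp
    assume notin: "p \<notin> (\<Sum>j<q. ?A j)"
    let ?B = "\<lambda>j. if j < q then ?A j else N #>\<^bsub>R\<^esub> p"
    have sumB: "(\<Sum>j<q. ?B j) = (\<Sum>j<q. ?A j)" by (intro sum.cong) auto
    have "direct_sum_family (insert q {..<q}) ?B"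
    proof (rule direct_sum_family_insert)
      have "Pi\<^sub>E {..<q} ?B = Pi\<^sub>E {..<q} ?A" by (intro PiE_cong) auto
      then show "direct_sum_family {..<q} ?B"
        using direct[of "{..<q}"] by (simp add: direct_sum_family_def)
      show "scalar_subspace E (?B j)" for j by (simp add: coset_sub)
      show "?B q \<inter> (\<Sum>j<q. ?B j) \<subseteq> {0}"
        unfolding sumB
      proof
        fix g assume "g \<in> ?B q \<inter> (\<Sum>j<q. ?A j)"
        then obtain c where c: "c \<in> E" "g = Polynomial.smult c p" and g: "g \<in> (\<Sum>j<q. ?A j)"
          by (auto simp: coset)
        \<comment> \<open>Otherwise dividing by \<open>c\<close> inside \<open>N\<close> would put \<open>p\<close> itself into the sum of the \<open>N t\<^sup>j\<^sup>s\<close>.\<close>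
        have "c = 0"
        proof (rule ccontr)
          assume "c \<noteq> 0"
          then have "inverse c \<in> E"
            using c(1) idealizer_constants_inverse[OF \<sigma> f0] by (simp add: E_def)
          then have "Polynomial.smult (inverse c) g \<in> (\<Sum>j<q. ?A j)"
            using g scalar_subspace_sum[of "{..<q}" E ?A, OF coset_sub]
            by (simp add: scalar_subspace_def)
          with notin \<open>c \<noteq> 0\<close> show False by (simp add: c(2))
        qed
        then show "g \<in> {0}" by (simp add: c(2))
      qed
    qed (use E in simp_all)
    also have "insert q {..<q} = {..q}" by auto
    finally show "direct_sum_family {..q} ?B" .
  next
    fix q r assume qr: "0 < r \<and> r < s \<and> m = q * s + r"
    have "j * s < m" if "j \<le> q" for j using mult_le_mono1[OF that, of s] qr by linarith
    then show "submodule (\<Sum>j\<le>q. N #>\<^bsub>R\<^esub> monom 1 (j * s)) F (S\<lparr>carrier := Nuc_r S\<rparr>)"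
      by (intro submod scalar_subspace_sum coset_sub sum_subset_scalar_subspace[OF Nuc_r_sub]
          t_coset) simp
    show "direct_sum_family {..q} (\<lambda>j. N #>\<^bsub>R\<^esub> monom 1 (j * s))" by (rule direct) simp
  qed
qed

end
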